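(* For a positive integer $n$, consider the partitions of $n$ in which each odd part is less than twice the smallest part. Let $d_o(n)$ be the number of such partitions with an odd number of parts and $d_e(n)$ the number of such partitions with an even number of parts. Then $$d_o(n)-d_e(n)=\begin{cases}(-1)^j, & \text{if } n=6j^2+4j+1 \text{ or } n=6j^2+8j+3 \text{ for some integer } j\ge 0,\\ 0, & \text{otherwise.}\end{cases}$$
   Context: A partition of $n$ is a finite multiset of positive integers (parts, repetitions allowed) with sum $n$; the number of parts is counted with multiplicity. There is no restriction on even parts (other than being at least the smallest part). *)

theory Defs
  imports Complex_Main "HOL-Library.Multiset"
begin

definition is_partition :: "nat \<Rightarrow> nat multiset \<Rightarrow> bool" where
  "is_partition n P \<longleftrightarrow> (\<forall>p \<in># P. 0 < p) \<and> sum_mset P = n"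

text \<open>\<^const>\<open>Min\<close> is unspecified on the empty set, so \<open>smallest_part\<close> is meaningful only for
  partitions of positive integers.\<close>

definition smallest_part :: "nat multiset \<Rightarrow> nat" where
  "smallest_part P = Min (set_mset P)"

definition restricted_partitions :: "nat \<Rightarrow> nat multiset set" where
  "restricted_partitions n =
     {P. is_partition n P \<and> (\<forall>p \<in># P. odd p \<longrightarrow> p < 2 * smallest_part P)}"

definition d_o :: "nat \<Rightarrow> nat" where
  "d_o n = card {P \<in> restricted_partitions n. odd (size P)}"

definition d_e :: "nat \<Rightarrow> nat" where
  "d_e n = card {P \<in> restricted_partitions n. even (size P)}"

text \<open>Finiteness guarantees that the cardinalities above are genuine counts.\<close>

lemma finite_restricted_partitions: "finite (restricted_partitions n)"
proof -
  have "restricted_partitions n \<subseteq> mset ` {xs. set xs \<subseteq> {..n} \<and> length xs \<le> n}"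
  proof
    fix P assume "P \<in> restricted_partitions n"
    then have pos: "\<forall>p \<in># P. 0 < p" and sum: "sum_mset P = n"
      by (auto simp: restricted_partitions_def is_partition_def)
    obtain xs where xs: "P = mset xs" by (metis ex_mset)
    have "sum_list xs = n" using sum xs by (simp add: sum_mset_sum_list)
    moreover have "length xs \<le> sum_list xs"
      using pos unfolding xs by (induction xs) auto
    moreover have "x \<le> sum_list xs" if "x \<in> set xs" for x
      using that by (intro member_le_sum_list) simp_all
    ultimately show "P \<in> mset ` {xs. set xs \<subseteq> {..n} \<and> length xs \<le> n}"
      using xs by auto
  qed
  then show ?thesis
    by (rule finite_subset) (simp add: finite_lists_length_le)
qed

end

theory Submission
  imports Defs "HOL-Computational_Algebra.Formal_Power_Series"
begin

text \<open>
  Let \<open>c(N, k)\<close> count the partitions of \<open>N\<close> into \<open>k\<close> parts whose odd parts are less than twice the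
  smallest part. A bijection gives \<open>c(N, k) = c(N - 1, k - 1) + c(N - 2k + 1, k)\<close> for \<open>k \<ge> 2\<close>:
  if the smallest part is at least 2 and occurs once, lower it by 1 and all other parts by 2;
  if 1 is a part, remove it; otherwise replace two copies of the smallest part \<open>s\<close> by
  \<open>2s - 1\<close>, which is then the largest odd part. Hence partitions into \<open>k\<close> parts have generating function
  \<open>q^k / (q; q^2)_k\<close>, and the theorem becomes the identity
  \<open>\<Sum>n\<ge>0. (-q)^n / (q; q^2)_{n+1} = \<Sum>j\<ge>0. (-1)^j q^{6j^2+4j} (1 + q^{4j+2})\<close>.
  It follows by two applications of the Rogers-Fine identity, through the intermediate series
  \<open>\<Sum>n\<ge>0. (-1)^n q^{2n^2+2n} / (q^2; q^4)_{n+1}\<close>. Each step embeds both sides into families satisfying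
  the same first-order recurrence, whose solution is unique \<open>q\<close>-adically; the recurrences are telescoping sums.
\<close>

unbundle fps_syntax

section \<open>Infinite sums of formal power series\<close>

definition diag_sum :: "(nat \<Rightarrow> 'a::comm_ring_1 fps) \<Rightarrow> 'a fps" where
  "diag_sum f = Abs_fps (\<lambda>N. \<Sum>n\<le>N. f n $ N)"

text \<open>\<^const>\<open>diag_sum\<close> is the infinite sum of the series \<open>f n\<close> only if \<open>f\<close> is adapted in the following sense.\<close>

definition adapted :: "(nat \<Rightarrow> 'a::comm_ring_1 fps) \<Rightarrow> bool" where
  "adapted f \<longleftrightarrow> (\<forall>n N. N < n \<longrightarrow> f n $ N = 0)"

lemma adaptedI: "(\<And>n. \<exists>e g. f n = g * fps_X ^ e \<and> n \<le> e) \<Longrightarrow> adapted f"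
  unfolding adapted_def
  by (metis fps_X_power_mult_right_nth order.strict_trans2)

lemma adapted_mult: "adapted f \<Longrightarrow> adapted (\<lambda>n. c n * f n)"
  by (auto simp: adapted_def fps_mult_nth intro!: sum.neutral)

lemma diag_sum_add: "diag_sum (\<lambda>n. f n + g n) = diag_sum f + diag_sum g"
  by (simp add: diag_sum_def fps_eq_iff sum.distrib)

lemma diag_sum_mult:
  assumes "adapted f"
  shows "c * diag_sum f = diag_sum (\<lambda>n. c * f n)"
proof (rule fps_ext)
  fix N
  \<comment> \<open>Terms with \<open>N - i < n\<close> vanish by adaptedness, so the inner range
    can be made independent of \<open>i\<close> and the two sums swapped.\<close>
  have "(\<Sum>n\<le>N - i. f n $ (N - i)) = (\<Sum>n\<le>N. f n $ (N - i))" for i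
    using assms by (intro sum.mono_neutral_left) (auto simp: adapted_def)
  then have "(c * diag_sum f) $ N = (\<Sum>i=0..N. \<Sum>n\<le>N. c $ i * f n $ (N - i))"
    by (simp add: diag_sum_def fps_mult_nth sum_distrib_left)
  also have "\<dots> = diag_sum (\<lambda>n. c * f n) $ N"
    by (simp add: diag_sum_def fps_mult_nth) (rule sum.swap)
  finally show "(c * diag_sum f) $ N = diag_sum (\<lambda>n. c * f n) $ N" .
qed

lemma diag_sum_telescope:
  assumes "adapted y" "\<And>n. f n = y n - y (Suc n)"
  shows "diag_sum f = y 0"
proof (rule fps_ext)
  fix N
  have "(\<Sum>n\<le>M. f n $ N) = y 0 $ N - y (Suc M) $ N" for M
    by (induction M) (simp_all add: assms(2))
  then show "diag_sum f $ N = y 0 $ N"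
    using assms(1) by (simp add: diag_sum_def adapted_def)
qed

lemma diag_sum_Suc:
  assumes "adapted f"
  shows "diag_sum f = f 0 + diag_sum (\<lambda>n. f (Suc n))"
proof (rule fps_ext)
  fix N
  \<comment> \<open>The shifted sum reaches one index further, to \<open>Suc N\<close>; by
    adaptedness that term contributes nothing to coefficient \<open>N\<close>.\<close>
  have "(\<Sum>n\<le>N. f n $ N) = (\<Sum>n\<le>Suc N. f n $ N)"
    using assms by (simp add: adapted_def)
  then show "diag_sum f $ N = (f 0 + diag_sum (\<lambda>n. f (Suc n))) $ N"
    by (simp add: diag_sum_def sum.atMost_Suc_shift del: sum.atMost_Suc)
qed

text \<open>Since \<open>c m\<close> is a unit, each use of the recurrence gains a factor
  \<open>fps_X\<close> from \<open>v m\<close>, so every power of \<open>fps_X\<close> divides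
  \<open>D m\<close>. Applied to the difference of two solutions, this is the q-adic
  uniqueness.\<close>

lemma fps_recurrence_zero:
  fixes D :: "nat \<Rightarrow> 'a::field fps"
  assumes rec: "\<And>m. c m * D m = v m * D (Suc m)"
    and unit: "\<And>m. c m $ 0 \<noteq> 0" and dvd: "\<And>m. fps_X dvd v m"
  shows "D m = 0"
proof -
  have div: "fps_X ^ k dvd D m" for k m
  proof (induction k arbitrary: m)
    case (Suc k)
    have "fps_X ^ Suc k dvd c m * D m"
      unfolding rec using mult_dvd_mono[OF dvd Suc.IH] by simp
    then show ?case
      using unit by (simp add: dvd_mult_unit_iff' fps_is_unit_iff)
  qed simp
  show ?thesis
  proof (rule fps_ext)
    fix N
    obtain g where "D m = fps_X ^ Suc N * g"
      using div by (meson dvdE)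
    then show "D m $ N = 0 $ N"
      by (simp add: fps_X_power_mult_nth del: power_Suc)
  qed
qed

text \<open>In the usual notation, \<open>inv_poch s b n\<close> is \<open>1 / (q^b; q^s)_n\<close>.\<close>

definition inv_poch :: "nat \<Rightarrow> nat \<Rightarrow> nat \<Rightarrow> 'a::field fps" where
  "inv_poch s b n = (\<Prod>i<n. inverse (1 - fps_X ^ (b + s * i)))"

lemma inv_poch_0 [simp]: "inv_poch s b 0 = 1"
  by (simp add: inv_poch_def)

lemma one_minus_X_power_inverse:
  "b > 0 \<Longrightarrow> (1 - fps_X ^ b) * inverse (1 - fps_X ^ b :: 'a::field fps) = 1"
  by (rule inverse_mult_eq_1') simp

lemma inv_poch_Suc:
  "b > 0 \<Longrightarrow> (1 - fps_X ^ (b + s * n)) * inv_poch s b (Suc n) = (inv_poch s b n :: 'a::field fps)"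
  using one_minus_X_power_inverse[of "b + s * n", where 'a = 'a]
  by (simp add: inv_poch_def mult.left_commute del: right_diff_distrib left_diff_distrib)

lemma inv_poch_shift:
  "b > 0 \<Longrightarrow> (1 - fps_X ^ b) * inv_poch s b (Suc n) = (inv_poch s (b + s) n :: 'a::field fps)"
  unfolding inv_poch_def
  by (subst prod.lessThan_Suc_shift)
     (simp add: mult.assoc[symmetric] one_minus_X_power_inverse add.assoc)

section \<open>The false theta identity\<close>

definition odd_poch_term :: "nat \<Rightarrow> nat \<Rightarrow> 'a::field fps" where
  "odd_poch_term m n = (- 1) ^ n * inv_poch 2 (2 * m + 1) (Suc n) * fps_X ^ ((2 * m + 1) * n)"

lemma adapted_odd_poch: "adapted (odd_poch_term m :: nat \<Rightarrow> 'a::field fps)"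
  unfolding odd_poch_term_def by (rule adaptedI) (metis le_add2 mult.commute mult_le_mono2 mult_1_right)

text \<open>The case \<open>m = 0\<close> is the series coming from partitions; general
  \<open>m\<close> is there to make a recurrence possible. With u = q^(2m+1), the left side plus the
  shifted series telescopes termwise, with certificate \<open>1 - u\<close> times the
  summand.\<close>

lemma odd_poch_rec:
  "(1 - fps_X ^ (4 * m + 2)) * diag_sum (odd_poch_term m)
     = 1 - fps_X ^ (4 * m + 4) * diag_sum (odd_poch_term (Suc m) :: nat \<Rightarrow> 'a::field fps)"
proof -
  define u s :: "'a fps" where "u = fps_X ^ (2 * m + 1)" and "s = fps_X ^ 2"
  define y where "y n = (1 - u) * (odd_poch_term m n :: 'a fps)" for n
  have "adapted y"
    unfolding y_def by (intro adapted_mult adapted_odd_poch)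
  moreover have "(1 - fps_X ^ (4 * m + 2)) * odd_poch_term m n + fps_X ^ (4 * m + 4) * odd_poch_term (Suc m) n
      = y n - y (Suc n)" for n
  proof -
    \<comment> \<open>Over the common denominator with n + 2 factors, the telescoping relation
      becomes a polynomial identity in \<open>u\<close>, \<open>s\<close> and \<open>w\<close>,
      times \<open>u ^ n * p\<close> and a sign.\<close>
    define p where "p = (inv_poch 2 (2 * m + 1) (Suc (Suc n)) :: 'a fps)"
    define w where "w = s ^ n"
    have 1: "inv_poch 2 (2 * m + 1) (Suc n) = (1 - u * w * s) * p"
    proof -
      have "u * w * s = fps_X ^ (2 * m + 1 + 2 * Suc n)"
        by (simp only: u_def w_def s_def flip: power_add power_mult) (rule arg_cong[where f = "(^) fps_X"], simp)
      then show ?thesis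
        using inv_poch_Suc[of "2 * m + 1" 2 "Suc n", where 'a = 'a] by (simp add: p_def)
    qed
    have 2: "inv_poch 2 (2 * Suc m + 1) (Suc n) = (1 - u) * p"
      using inv_poch_shift[of "2 * m + 1" 2 "Suc n", where 'a = 'a]
      by (simp add: p_def u_def)
    have 3: "fps_X ^ (4 * m + 2) = u * u" "fps_X ^ (4 * m + 4) = u * u * s"
      by (simp_all only: u_def s_def flip: power_add) (rule arg_cong[where f = "(^) fps_X"], simp)+
    have 4: "fps_X ^ ((2 * Suc m + 1) * n) = u ^ n * w" "fps_X ^ ((2 * m + 1) * n) = u ^ n"
      "fps_X ^ ((2 * m + 1) * Suc n) = u ^ n * u"
      by (simp_all only: u_def s_def w_def flip: power_add power_mult) (rule arg_cong[where f = "(^) fps_X"], simp add: algebra_simps)+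
    show ?thesis
      unfolding odd_poch_term_def y_def 1 2 3 4 p_def[symmetric]
      by (simp add: algebra_simps)
  qed
  ultimately have "diag_sum (\<lambda>n. (1 - fps_X ^ (4 * m + 2)) * odd_poch_term m n
      + fps_X ^ (4 * m + 4) * odd_poch_term (Suc m) n) = y 0"
    by (rule diag_sum_telescope)
  moreover have "y 0 = 1"
    using inv_poch_shift[of "2 * m + 1" 2 0, where 'a = 'a]
    by (simp add: y_def odd_poch_term_def u_def)
  ultimately show ?thesis
    by (simp only: diag_sum_add diag_sum_mult[OF adapted_odd_poch, symmetric] eq_diff_eq)
qed

text \<open>Two free parameters allow two families through \<open>a = b = 2\<close>: (4m+2, 4m+2)
  matches \<open>odd_poch_term m\<close>, while (8j+2, 4j+2) leads to the theta series.\<close>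

definition gauss_term :: "nat \<Rightarrow> nat \<Rightarrow> nat \<Rightarrow> 'a::field fps" where
  "gauss_term a b n = (- 1) ^ n * inv_poch 4 b (Suc n) * fps_X ^ (2 * n ^ 2 + a * n)"

lemma adapted_gauss: "adapted (gauss_term a b :: nat \<Rightarrow> 'a::field fps)"
  unfolding gauss_term_def
proof (rule adaptedI)
  fix n :: nat
  have "n \<le> 2 * n ^ 2 + a * n" by (simp add: power2_eq_square trans_le_add1)
  then show "\<exists>e g. (- 1) ^ n * inv_poch 4 b (Suc n) * fps_X ^ (2 * n ^ 2 + a * n)
      = (g :: 'a fps) * fps_X ^ e \<and> n \<le> e"
    by blast
qed

text \<open>Multiplying by 1 - q^b cancels the first denominator factor. The terms after the first
  then form the shifted series up to sign, because 2(n+1)^2 + a(n+1) = (a+2) + 2n^2 +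
  (a+4)n.\<close>

lemma gauss_rec:
  assumes "b > 0"
  shows "(1 - fps_X ^ b) * diag_sum (gauss_term a b)
     = 1 - fps_X ^ (a + 2) * diag_sum (gauss_term (a + 4) (b + 4) :: nat \<Rightarrow> 'a::field fps)"
proof -
  define y where "y n = (1 - fps_X ^ b) * (gauss_term a b n :: 'a fps)" for n
  have "adapted y"
    unfolding y_def by (intro adapted_mult adapted_gauss)
  moreover have "(1 - fps_X ^ b) * gauss_term a b n + fps_X ^ (a + 2) * gauss_term (a + 4) (b + 4) n
      = y n - y (Suc n)" for n
  proof -
    have "fps_X ^ (a + 2) * gauss_term (a + 4) (b + 4) n
        = (- 1) ^ n * ((1 - fps_X ^ b) * inv_poch 4 b (Suc (Suc n)))
          * (fps_X ^ (a + 2) * fps_X ^ (2 * n ^ 2 + (a + 4) * n) :: 'a fps)"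
      using assms by (simp add: gauss_term_def inv_poch_shift mult_ac)
    also have "fps_X ^ (a + 2) * fps_X ^ (2 * n ^ 2 + (a + 4) * n)
        = (fps_X ^ (2 * Suc n ^ 2 + a * Suc n) :: 'a fps)"
      by (simp only: flip: power_add) (rule arg_cong[where f = "(^) fps_X"], simp add: power2_eq_square algebra_simps)
    also have "(- 1) ^ n * ((1 - fps_X ^ b) * inv_poch 4 b (Suc (Suc n)))
          * (fps_X ^ (2 * Suc n ^ 2 + a * Suc n) :: 'a fps) = - y (Suc n)"
      unfolding y_def gauss_term_def by (simp only: power_Suc) (simp add: algebra_simps)
    finally show ?thesis by (simp add: y_def)
  qed
  ultimately have "diag_sum (\<lambda>n. (1 - fps_X ^ b) * gauss_term a b n
      + fps_X ^ (a + 2) * gauss_term (a + 4) (b + 4) n) = y 0"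
    by (rule diag_sum_telescope)
  moreover have "y 0 = 1"
    using inv_poch_shift[of b 4 0, where 'a = 'a] assms
    by (simp add: y_def gauss_term_def)
  ultimately show ?thesis
    by (simp only: diag_sum_add diag_sum_mult[OF adapted_gauss, symmetric] eq_diff_eq)
qed

text \<open>For \<open>a = b = 4 * m + 2\<close> both families obey the same recurrence, so their
  difference obeys the homogeneous one.\<close>

lemma odd_poch_eq_gauss: "diag_sum (odd_poch_term 0) = (diag_sum (gauss_term 2 2) :: 'a::field fps)"
proof -
  define D where "D m = diag_sum (odd_poch_term m) - (diag_sum (gauss_term (4 * m + 2) (4 * m + 2)) :: 'a fps)" for m
  have "D 0 = 0"
  proof (rule fps_recurrence_zero)
    fix m
    show "(1 - fps_X ^ (4 * m + 2)) * D m = - (fps_X ^ (4 * m + 4)) * D (Suc m)"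
    proof -
      have "4 * m + 2 + 4 = 4 * Suc m + 2" "4 * m + 2 + 2 = 4 * m + 4" by simp_all
      then have "(1 - fps_X ^ (4 * m + 2)) * diag_sum (gauss_term (4 * m + 2) (4 * m + 2))
          = 1 - fps_X ^ (4 * m + 4) * (diag_sum (gauss_term (4 * Suc m + 2) (4 * Suc m + 2)) :: 'a fps)"
        using gauss_rec[of "4 * m + 2" "4 * m + 2", where 'a = 'a] by (simp only:)
      then show ?thesis
        unfolding D_def right_diff_distrib odd_poch_rec by simp
    qed
    show "(1 - fps_X ^ (4 * m + 2) :: 'a fps) $ 0 \<noteq> 0" by simp
    show "fps_X dvd - (fps_X ^ (4 * m + 4) :: 'a fps)" by simp
  qed
  then show ?thesis by (simp add: D_def numeral_2_eq_2)
qed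

section \<open>Second transformation: to the false theta series\<close>

lemma gauss_theta_rec:
  "diag_sum (gauss_term (8 * j + 2) (4 * j + 2)) = 1 + fps_X ^ (4 * j + 2)
     - fps_X ^ (12 * j + 10) * diag_sum (gauss_term (8 * Suc j + 2) (4 * Suc j + 2) :: nat \<Rightarrow> 'a::field fps)"
proof -
  define u s :: "'a fps" where "u = fps_X ^ (4 * j + 2)" and "s = fps_X ^ 4"
  let ?g = "\<lambda>j. gauss_term (8 * j + 2) (4 * j + 2) :: nat \<Rightarrow> 'a fps"
  \<comment> \<open>The telescoping certificate: at n = 0 the factor is (1 - u)(1 + u), whose first
    half cancels the denominator and leaves the inhomogeneous term 1 + u.\<close>
  define y where "y n = (1 - u * u * s ^ n) * ?g j n" for n
  have "adapted y"
    unfolding y_def by (intro adapted_mult adapted_gauss)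
  moreover have "?g j n + fps_X ^ (12 * j + 10) * ?g (Suc j) n = y n - y (Suc n)" for n
  proof -
    define p where "p = (inv_poch 4 (4 * j + 2) (Suc (Suc n)) :: 'a fps)"
    define w where "w = s ^ n"
    define x where "x = (fps_X ^ (2 * n ^ 2 + (8 * j + 2) * n) :: 'a fps)"
    have 1: "inv_poch 4 (4 * j + 2) (Suc n) = (1 - u * w * s) * p"
    proof -
      have "u * w * s = fps_X ^ (4 * j + 2 + 4 * Suc n)"
        by (simp only: u_def w_def s_def flip: power_add power_mult) (rule arg_cong[where f = "(^) fps_X"], simp)
      then show ?thesis
        using inv_poch_Suc[of "4 * j + 2" 4 "Suc n", where 'a = 'a] by (simp add: p_def)
    qed
    have 2: "inv_poch 4 (4 * Suc j + 2) (Suc n) = (1 - u) * p"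
      using inv_poch_shift[of "4 * j + 2" 4 "Suc n", where 'a = 'a]
      by (simp add: p_def u_def add_ac)
    have 3: "fps_X ^ (12 * j + 10) = u * u * u * s"
      by (simp only: u_def s_def flip: power_add) (rule arg_cong[where f = "(^) fps_X"], simp)
    have 4: "fps_X ^ (2 * n ^ 2 + (8 * Suc j + 2) * n) = x * w * w"
      "fps_X ^ (2 * Suc n ^ 2 + (8 * j + 2) * Suc n) = x * w * u * u"
      by (simp_all only: x_def u_def s_def w_def flip: power_add power_mult)
        (rule arg_cong[where f = "(^) fps_X"], simp add: power2_eq_square algebra_simps)+
    have 5: "s ^ Suc n = w * s" by (simp add: w_def)
    show ?thesis
      unfolding gauss_term_def y_def 1 2 3 4 5 p_def[symmetric] w_def[symmetric] x_def[symmetric]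
      by (simp add: algebra_simps)
  qed
  ultimately have "diag_sum (\<lambda>n. ?g j n + fps_X ^ (12 * j + 10) * ?g (Suc j) n) = y 0"
    by (rule diag_sum_telescope)
  moreover have "y 0 = 1 + u"
  proof -
    have "y 0 = (1 + u) * ((1 - u) * inv_poch 4 (4 * j + 2) (Suc 0))"
      by (simp add: y_def gauss_term_def algebra_simps)
    also have "(1 - u) * inv_poch 4 (4 * j + 2) (Suc 0) = 1"
      using inv_poch_shift[of "4 * j + 2" 4 0, where 'a = 'a] by (simp add: u_def)
    finally show ?thesis by simp
  qed
  ultimately show ?thesis
    by (simp only: diag_sum_add diag_sum_mult[OF adapted_gauss, symmetric] u_def eq_diff_eq)
qed

text \<open>These are the terms of the false theta series from index \<open>j\<close> on, divided by
  (-1)^j q^(6j^2+4j); the division produces the cross term 12ji.\<close>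

definition theta_term :: "nat \<Rightarrow> nat \<Rightarrow> 'a::field fps" where
  "theta_term j i = (- 1) ^ i * (1 + fps_X ^ (4 * (j + i) + 2)) * fps_X ^ (6 * i ^ 2 + (12 * j + 4) * i)"

lemma adapted_theta: "adapted (theta_term j :: nat \<Rightarrow> 'a::field fps)"
  unfolding theta_term_def
proof (rule adaptedI)
  fix i :: nat
  have "i \<le> 6 * i ^ 2 + (12 * j + 4) * i" by (simp add: power2_eq_square trans_le_add2)
  then show "\<exists>e g. (- 1) ^ i * (1 + fps_X ^ (4 * (j + i) + 2)) * fps_X ^ (6 * i ^ 2 + (12 * j + 4) * i)
      = (g :: 'a fps) * fps_X ^ e \<and> i \<le> e"
    by blast
qed

text \<open>Splitting off the first term of a tail leaves the next tail; 12j + 10 is the increment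
  of 6j^2 + 4j from j to j + 1.\<close>

lemma theta_rec:
  "diag_sum (theta_term j) = 1 + fps_X ^ (4 * j + 2)
     - fps_X ^ (12 * j + 10) * diag_sum (theta_term (Suc j) :: nat \<Rightarrow> 'a::field fps)"
proof -
  have "theta_term j (Suc i) = - (fps_X ^ (12 * j + 10)) * (theta_term (Suc j) i :: 'a fps)" for i
  proof -
    have "(fps_X ^ (6 * Suc i ^ 2 + (12 * j + 4) * Suc i) :: 'a fps)
        = fps_X ^ (12 * j + 10) * fps_X ^ (6 * i ^ 2 + (12 * Suc j + 4) * i)"
      by (simp only: flip: power_add) (rule arg_cong[where f = "(^) fps_X"], simp add: power2_eq_square algebra_simps)
    then show ?thesis
      unfolding theta_term_def by (simp only: power_Suc) (simp add: mult_ac)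
  qed
  then have "diag_sum (\<lambda>i. theta_term j (Suc i)) =
      - (fps_X ^ (12 * j + 10)) * diag_sum (theta_term (Suc j) :: nat \<Rightarrow> 'a fps)"
    by (simp add: diag_sum_mult[OF adapted_theta])
  then show ?thesis
    using diag_sum_Suc[OF adapted_theta[of j, where 'a = 'a]] by (simp add: theta_term_def)
qed

lemma gauss_eq_theta: "diag_sum (gauss_term 2 2) = (diag_sum (theta_term 0) :: 'a::field fps)"
proof -
  define D where "D j = diag_sum (gauss_term (8 * j + 2) (4 * j + 2)) - (diag_sum (theta_term j) :: 'a fps)" for j
  have "D 0 = 0"
  proof (rule fps_recurrence_zero)
    fix j
    show "1 * D j = - (fps_X ^ (12 * j + 10)) * D (Suc j)"
      using gauss_theta_rec[of j, where 'a = 'a] theta_rec[of j, where 'a = 'a]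
      by (simp add: D_def algebra_simps)
    show "fps_X dvd - (fps_X ^ (12 * j + 10) :: 'a fps)" by simp
  qed simp
  then show ?thesis by (simp add: D_def numeral_2_eq_2)
qed

section \<open>Counting the partitions by their number of parts\<close>

text \<open>Here \<open>Q\<close> is what remains after removing one copy of the smallest part
  \<open>s\<close>; it may be empty or contain \<open>s\<close> again.\<close>

definition least_part :: "nat \<Rightarrow> nat multiset \<Rightarrow> bool" where
  "least_part s Q \<longleftrightarrow> 0 < s \<and> (\<forall>q \<in># Q. s \<le> q \<and> (odd q \<longrightarrow> q < 2 * s))"

definition partitions_size :: "nat \<Rightarrow> nat \<Rightarrow> nat multiset set" where
  "partitions_size k N = {P \<in> restricted_partitions N. size P = k}"

lemma finite_partitions_size: "finite (partitions_size k N)"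
  by (simp add: partitions_size_def finite_restricted_partitions)

text \<open>Being below twice the minimum means being below twice every part. This form avoids
  \<open>Min\<close>, and on the empty multiset the conditions on both sides are vacuous.\<close>

lemma mem_partitions_size:
  "P \<in> partitions_size k N \<longleftrightarrow> size P = k \<and> sum_mset P = N \<and>
     (\<forall>p \<in># P. 0 < p \<and> (odd p \<longrightarrow> (\<forall>s \<in># P. p < 2 * s)))"
proof (cases "P = {#}")
  case False
  then have "p < 2 * smallest_part P \<longleftrightarrow> (\<forall>s \<in># P. p < 2 * s)" for p
    by (metis Min_in Min_le finite_set_mset less_le_trans mult_le_mono2 set_mset_eq_empty_iff smallest_part_def)
  then show ?thesis
    by (auto simp: partitions_size_def restricted_partitions_def is_partition_def)
qed (auto simp: partitions_size_def restricted_partitions_def is_partition_def)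

lemma least_part_mem:
  assumes "least_part s Q"
  shows "add_mset s Q \<in> partitions_size k N \<longleftrightarrow> Suc (size Q) = k \<and> s + sum_mset Q = N"
proof -
  have "0 < p \<and> (odd p \<longrightarrow> (\<forall>r \<in># add_mset s Q. p < 2 * r))" if "p \<in># add_mset s Q" for p
  proof (intro conjI impI ballI)
    show "0 < p" using that assms by (auto simp: least_part_def dest!: bspec)
    fix r assume r: "r \<in># add_mset s Q" and "odd p"
    have "p < 2 * s" using that assms \<open>odd p\<close> by (auto simp: least_part_def)
    also have "s \<le> r" using r assms by (auto simp: least_part_def)
    finally show "p < 2 * r" by simp
  qed
  then show ?thesis by (simp add: mem_partitions_size)
qed

lemma least_part_ex:
  assumes "P \<in> partitions_size (Suc k) N"
  obtains s Q where "P = add_mset s Q" "least_part s Q"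
proof -
  let ?s = "Min (set_mset P)"
  have "P \<noteq> {#}" using assms by (auto simp: mem_partitions_size)
  then have s: "?s \<in># P" by (metis Min_in finite_set_mset set_mset_eq_empty_iff)
  have "least_part ?s (P - {#?s#})"
    using assms s by (auto simp: least_part_def mem_partitions_size dest!: in_diffD)
  then show thesis using that s by (metis insert_DiffM)
qed

lemma least_part_unique:
  assumes "add_mset s Q = add_mset s' Q'" "least_part s Q" "least_part s' Q'"
  shows "s = s'" "Q = Q'"
proof -
  have "s \<in># add_mset s' Q'" "s' \<in># add_mset s Q"
    using assms(1) by (metis union_single_eq_member)+
  then have "s' \<le> s" "s \<le> s'" using assms(2,3) by (auto simp: least_part_def)
  then show "s = s'" by simp
  then show "Q = Q'" using assms(1) by simp
qed

lemma bij_least_part: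
  "bij_betw (\<lambda>(s, Q). add_mset s Q)
     {(s, Q). least_part s Q \<and> size Q = k \<and> s + sum_mset Q = N} (partitions_size (Suc k) N)"
  unfolding bij_betw_def
proof
  show "inj_on (\<lambda>(s, Q). add_mset s Q) {(s, Q). least_part s Q \<and> size Q = k \<and> s + sum_mset Q = N}"
    by (auto simp: inj_on_def dest: least_part_unique)
  show "(\<lambda>(s, Q). add_mset s Q) ` {(s, Q). least_part s Q \<and> size Q = k \<and> s + sum_mset Q = N}
      = partitions_size (Suc k) N"
  proof (intro equalityI subsetI)
    fix P assume P: "P \<in> partitions_size (Suc k) N"
    then obtain s Q where "P = add_mset s Q" "least_part s Q" by (rule least_part_ex)
    then show "P \<in> (\<lambda>(s, Q). add_mset s Q) ` {(s, Q). least_part s Q \<and> size Q = k \<and> s + sum_mset Q = N}"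
      using P by (force simp: least_part_mem)
  qed (auto simp: least_part_mem)
qed

section \<open>The bijections behind the recurrence\<close>

text \<open>The odd-part condition is preserved because q < 2s iff q + 2 < 2(s + 1), and q + 2 > s +
  1 makes the new smallest part occur once. The map adds 1 to \<open>s\<close> and 2 to each of the
  \<open>k\<close> other parts.\<close>

lemma bij_shift:
  "bij_betw (\<lambda>(s, Q). add_mset (Suc s) (image_mset (\<lambda>q. q + 2) Q))
     {(s, Q). least_part s Q \<and> size Q = k \<and> s + sum_mset Q + (2 * k + 1) = N}
     {P \<in> partitions_size (Suc k) N. \<exists>s Q. P = add_mset s Q \<and> least_part s Q \<and> 2 \<le> s \<and> s \<notin># Q}"
    (is "bij_betw ?f ?A ?B")
proof -
  have least_part: "least_part (Suc s) (image_mset (\<lambda>q. q + 2) Q)" if "least_part s Q" for s Q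
    using that by (auto simp: least_part_def)
  have sum: "sum_mset (image_mset (\<lambda>q. q + 2) Q) = sum_mset Q + 2 * size Q" for Q :: "nat multiset"
    by (induction Q) auto
  have "inj_on ?f ?A"
  proof (rule inj_onI, clarify)
    fix s Q s' Q'
    assume "least_part s Q" "least_part s' Q'"
      and eq: "add_mset (Suc s) (image_mset (\<lambda>q. q + 2) Q) = add_mset (Suc s') (image_mset (\<lambda>q. q + 2) Q')"
    then have "Suc s = Suc s'" "image_mset (\<lambda>q. q + 2) Q = image_mset (\<lambda>q. q + 2) Q'"
      using least_part_unique[OF eq least_part least_part] by simp_all
    moreover have "inj (\<lambda>q::nat. q + 2)" by (simp add: inj_def)
    ultimately show "s = s' \<and> Q = Q'"
      using multiset.inj_map by (metis Suc_inject injD)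
  qed
  moreover have "?f ` ?A = ?B"
  proof (intro equalityI subsetI)
    fix P assume "P \<in> ?f ` ?A"
    then obtain s Q where sQ: "least_part s Q" "size Q = k" "s + sum_mset Q + (2 * k + 1) = N"
      and P: "P = add_mset (Suc s) (image_mset (\<lambda>q. q + 2) Q)" by auto
    have "2 \<le> Suc s" "Suc s \<notin># image_mset (\<lambda>q. q + 2) Q"
      using sQ(1) by (auto simp: least_part_def)
    moreover have "P \<in> partitions_size (Suc k) N"
      unfolding P least_part_mem[OF least_part[OF sQ(1)]] sum using sQ by simp
    ultimately show "P \<in> ?B"
      using least_part[OF sQ(1)] P by blast
  next
    fix P assume "P \<in> ?B"
    then obtain s Q where P: "P \<in> partitions_size (Suc k) N" "P = add_mset s Q"
      and sQ: "least_part s Q" "2 \<le> s" "s \<notin># Q" by auto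
    define R where "R = image_mset (\<lambda>q. q - 2) Q"
    \<comment> \<open>As \<open>s\<close> occurs only once, q >= s + 1 >= 3, so \<open>q - 2\<close>
      is a true subtraction and stays at least \<open>s - 1\<close>.\<close>
    have gt: "s + 1 \<le> q" if "q \<in># Q" for q
      using that sQ by (metis Suc_eq_plus1 Suc_leI least_part_def le_neq_implies_less)
    have Q: "Q = image_mset (\<lambda>q. q + 2) R"
    proof -
      have "image_mset (\<lambda>q. q - 2 + 2) Q = image_mset (\<lambda>q. q) Q"
        by (rule image_mset_cong) (use gt sQ in force)
      then show ?thesis by (simp add: R_def image_mset.compositionality comp_def)
    qed
    have R: "least_part (s - 1) R"
      using sQ gt by (fastforce simp: least_part_def R_def)
    have "size Q = k" "s + sum_mset Q = N"
      using P(1) unfolding P(2) least_part_mem[OF sQ(1)] by simp_all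
    moreover have "size Q = size R" "sum_mset Q = sum_mset R + 2 * size R"
      by (subst Q, simp, subst Q, rule sum)
    ultimately have "s - 1 + sum_mset R + (2 * k + 1) = N" "size R = k"
      using sQ(2) by simp_all
    then have "(s - 1, R) \<in> ?A" using R by simp
    moreover have "P = ?f (s - 1, R)" using P(2) Q sQ(2) by simp
    ultimately show "P \<in> ?f ` ?A" by (rule rev_image_eqI)
  qed
  ultimately show ?thesis unfolding bij_betw_def by blast
qed

text \<open>Next to a part 1, odd parts must be below 2, hence equal to 1; conversely a 1 can be
  added whenever all odd parts are 1.\<close>

lemma bij_remove_one:
  "bij_betw (add_mset 1) {P \<in> partitions_size k N. \<forall>p \<in># P. odd p \<longrightarrow> p = 1}
     {P \<in> partitions_size (Suc k) (Suc N). 1 \<in># P}" (is "bij_betw _ ?A ?B")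
  unfolding bij_betw_def
proof
  show "add_mset 1 ` ?A = ?B"
  proof (intro equalityI subsetI)
    fix P assume "P \<in> add_mset 1 ` ?A"
    then show "P \<in> ?B" by (fastforce simp: mem_partitions_size)
  next
    fix P assume P: "P \<in> ?B"
    then obtain Q where Q: "P = add_mset 1 Q" by (metis (lifting) insert_DiffM mem_Collect_eq)
    have "Q \<in> ?A" using P unfolding Q by (fastforce simp: mem_partitions_size)
    then show "P \<in> add_mset 1 ` ?A" using Q by blast
  qed
qed (simp add: inj_on_def)

text \<open>The pair stands for two copies of \<open>s\<close> together with \<open>Q\<close>.
  Merging them into 2s - 1 lowers the sum by 1, and \<open>s\<close> is recoverable because odd
  parts of \<open>Q\<close> are below 2s, which makes 2s - 1 the largest odd part.\<close>

lemma bij_odd: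
  "bij_betw (\<lambda>(s, Q). add_mset (2 * s - 1) Q)
     {(s, Q). least_part s Q \<and> 2 \<le> s \<and> size Q = k \<and> 2 * s + sum_mset Q = Suc N}
     {P \<in> partitions_size (Suc k) N. \<exists>p \<in># P. odd p \<and> p \<noteq> 1}" (is "bij_betw ?f ?A ?B")
proof -
  have "inj_on ?f ?A"
  proof (rule inj_onI, clarify)
    fix s Q s' Q'
    assume lp: "least_part s Q" "least_part s' Q'" "2 \<le> s" "2 \<le> s'"
      and eq: "add_mset (2 * s - 1) Q = add_mset (2 * s' - 1) Q'"
    have le: "a \<le> b" if "least_part a A" "least_part b B" "2 \<le> a"
      and eq: "add_mset (2 * a - 1) A = add_mset (2 * b - 1) B" for a b A B
    proof -
      have "2 * a - 1 \<in># add_mset (2 * b - 1) B"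
        using eq by (metis union_single_eq_member)
      moreover have "odd (2 * a - 1)" using that by simp
      ultimately show ?thesis using that by (auto simp: least_part_def)
    qed
    have "s = s'"
      using le[OF lp(1,2,3) eq] le[OF lp(2,1,4) eq[symmetric]] by simp
    then show "s = s' \<and> Q = Q'" using eq by simp
  qed
  moreover have "?f ` ?A = ?B"
  proof (intro equalityI subsetI)
    fix P assume "P \<in> ?f ` ?A"
    then obtain s Q where sQ: "least_part s Q" "2 \<le> s" "size Q = k" "2 * s + sum_mset Q = Suc N"
      and P: "P = add_mset (2 * s - 1) Q" by auto
    have "0 < p \<and> (odd p \<longrightarrow> p < 2 * r)" if "p \<in># P" "r \<in># P" for p r
      using that sQ unfolding P least_part_def by (auto; fastforce)
    then have "P \<in> partitions_size (Suc k) N"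
      using sQ by (auto simp: mem_partitions_size P)
    moreover have "2 * s - 1 \<in># P" "odd (2 * s - 1)" "2 * s - 1 \<noteq> 1"
      using sQ(2) by (auto simp: P)
    ultimately show "P \<in> ?B" by blast
  next
    fix P assume P: "P \<in> ?B"
    define odds where "odds = {p \<in> set_mset P. odd p}"
    have fin: "finite odds" by (simp add: odds_def)
    define m where "m = Max odds"
    have ne: "odds \<noteq> {}" using P by (auto simp: odds_def)
    have m: "m \<in># P" "odd m" using Max_in[OF fin ne] by (simp_all add: m_def odds_def)
    have max: "p \<le> m" if "p \<in># P" "odd p" for p
      using Max_ge[OF fin] that by (simp add: m_def odds_def)
    have "3 \<le> m"
    proof -
      obtain p where "p \<in># P" "odd p" "p \<noteq> 1" using P by blast
      then have "p \<le> m" "3 \<le> p" using max by (auto elim!: oddE)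
      then show ?thesis by simp
    qed
    obtain s where s: "m = 2 * s - 1" "2 \<le> s"
    proof
      show "m = 2 * ((m + 1) div 2) - 1" "2 \<le> (m + 1) div 2"
        using m(2) \<open>3 \<le> m\<close> by (auto elim!: oddE)
    qed
    obtain Q where Q: "P = add_mset m Q" using m(1) by (metis insert_DiffM)
    \<comment> \<open>From 2s - 1 = m < 2q follows s <= q, and maximality of \<open>m\<close> bounds
      the odd parts of \<open>Q\<close> by 2s - 1.\<close>
    have "least_part s Q"
      unfolding least_part_def
    proof (intro conjI ballI impI)
      show "0 < s" using s by simp
      fix q assume q: "q \<in># Q"
      then have "m < 2 * q" using P m by (auto simp: mem_partitions_size Q)
      then show "s \<le> q" using s by simp
      assume "odd q"
      then show "q < 2 * s" using max[of q] q s by (simp add: Q)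
    qed
    then have "(s, Q) \<in> ?A" using P s by (auto simp: mem_partitions_size Q)
    moreover have "P = ?f (s, Q)" using Q s by simp
    ultimately show "P \<in> ?f ` ?A" by (rule rev_image_eqI)
  qed
  ultimately show ?thesis unfolding bij_betw_def by blast
qed

text \<open>With \<open>Suc N\<close> for \<open>N\<close>, the domain is that of
  \<open>bij_odd\<close>, so the two images have equal cardinality.\<close>

lemma bij_double:
  "bij_betw (\<lambda>(s, Q). add_mset s (add_mset s Q))
     {(s, Q). least_part s Q \<and> 2 \<le> s \<and> size Q = k \<and> 2 * s + sum_mset Q = N}
     {P \<in> partitions_size (Suc (Suc k)) N. \<exists>s Q. P = add_mset s Q \<and> least_part s Q \<and> 2 \<le> s \<and> s \<in># Q}"
    (is "bij_betw ?f ?A ?B")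
proof -
  have least_part: "least_part s (add_mset s Q) \<longleftrightarrow> least_part s Q" for s Q
    by (auto simp: least_part_def)
  have "inj_on ?f ?A"
  proof (rule inj_onI, clarify)
    fix s Q s' Q'
    assume "least_part s Q" "least_part s' Q'" and eq: "add_mset s (add_mset s Q) = add_mset s' (add_mset s' Q')"
    then show "s = s' \<and> Q = Q'"
      using least_part_unique[OF eq] by (auto simp: least_part)
  qed
  moreover have "?f ` ?A = ?B"
  proof (intro equalityI subsetI)
    fix P assume "P \<in> ?f ` ?A"
    then obtain s Q where sQ: "least_part s Q" "2 \<le> s" "size Q = k" "2 * s + sum_mset Q = N"
      and P: "P = add_mset s (add_mset s Q)" by auto
    have "least_part s (add_mset s Q)" using sQ(1) by (simp add: least_part)
    moreover from this have "P \<in> partitions_size (Suc (Suc k)) N"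
      using sQ by (simp add: P least_part_mem)
    moreover have "s \<in># add_mset s Q" by simp
    ultimately show "P \<in> ?B" using P sQ(2) by blast
  next
    fix P assume "P \<in> ?B"
    then obtain s R where P: "P \<in> partitions_size (Suc (Suc k)) N" "P = add_mset s R"
      and sR: "least_part s R" "2 \<le> s" "s \<in># R" by auto
    obtain Q where Q: "R = add_mset s Q" using sR(3) by (metis insert_DiffM)
    have "(s, Q) \<in> ?A" using P sR by (simp add: least_part_mem Q least_part)
    moreover have "P = ?f (s, Q)" using P(2) Q by simp
    ultimately show "P \<in> ?f ` ?A" by (rule rev_image_eqI)
  qed
  ultimately show ?thesis unfolding bij_betw_def by blast
qed

lemma card_partitions_size_rec:
  "card (partitions_size (Suc (Suc k)) (Suc N)) = card (partitions_size (Suc k) N)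
     + (if 2 * k + 3 \<le> Suc N then card (partitions_size (Suc (Suc k)) (Suc N - (2 * k + 3))) else 0)"
proof -
  let ?A = "partitions_size (Suc (Suc k)) (Suc N)" and ?C = "partitions_size (Suc k) N"
  let ?one = "{P \<in> ?A. 1 \<in># P}"
  let ?double = "{P \<in> ?A. \<exists>s Q. P = add_mset s Q \<and> least_part s Q \<and> 2 \<le> s \<and> s \<in># Q}"
  let ?single = "{P \<in> ?A. \<exists>s Q. P = add_mset s Q \<and> least_part s Q \<and> 2 \<le> s \<and> s \<notin># Q}"
  let ?C1 = "{P \<in> ?C. \<forall>p \<in># P. odd p \<longrightarrow> p = 1}"
  let ?C2 = "{P \<in> ?C. \<exists>p \<in># P. odd p \<and> p \<noteq> 1}"
  \<comment> \<open>Either 1 is a part, or the smallest part is at least 2 and is repeated or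
    single. The first two classes match \<open>?C1\<close> and \<open>?C2\<close>, which together
    exhaust \<open>?C\<close>; the third gives the last summand.\<close>
  have "?A = ?one \<union> (?double \<union> ?single)"
  proof (intro equalityI subsetI)
    fix P assume P: "P \<in> ?A"
    then obtain s Q where sQ: "P = add_mset s Q" "least_part s Q" by (rule least_part_ex)
    show "P \<in> ?one \<union> (?double \<union> ?single)"
    proof (cases "s = 1")
      case False
      then have "2 \<le> s" using sQ(2) by (simp add: least_part_def)
      then show ?thesis using P sQ by blast
    qed (use P sQ in simp)
  qed auto
  moreover have "?double \<inter> ?single = {}"
    using least_part_unique by blast
  moreover have "?one \<inter> (?double \<union> ?single) = {}"
    by (fastforce simp: least_part_def)
  moreover have "finite ?one" "finite ?double" "finite ?single"
    by (simp_all add: finite_partitions_size)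
  ultimately have "card ?A = card ?one + (card ?double + card ?single)"
    by (metis (no_types, lifting) card_Un_disjoint finite_UnI)
  moreover have "card ?one = card ?C1"
    using bij_betw_same_card[OF bij_remove_one] by metis
  moreover have "card ?double = card ?C2"
    using bij_betw_same_card[OF bij_double] bij_betw_same_card[OF bij_odd] by metis
  moreover have "card ?C = card ?C1 + card ?C2"
    by (subst card_Un_disjoint[symmetric])
       (auto simp: finite_partitions_size intro!: arg_cong[where f = card])
  moreover have "card ?single = (if 2 * k + 3 \<le> Suc N
      then card (partitions_size (Suc (Suc k)) (Suc N - (2 * k + 3))) else 0)"
  proof -
    let ?I = "{(s, Q). least_part s Q \<and> size Q = Suc k \<and> s + sum_mset Q + (2 * Suc k + 1) = Suc N}"
    have "card ?single = card ?I"
      using bij_betw_same_card[OF bij_shift] by metis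
    also have "\<dots> = (if 2 * k + 3 \<le> Suc N
        then card (partitions_size (Suc (Suc k)) (Suc N - (2 * k + 3))) else 0)"
    proof (cases "2 * k + 3 \<le> Suc N")
      case True
      then have "?I = {(s, Q). least_part s Q \<and> size Q = Suc k \<and> s + sum_mset Q = Suc N - (2 * k + 3)}"
        by auto
      then show ?thesis
        using True bij_betw_same_card[OF bij_least_part] by simp
    next
      case False
      then have "?I = {}" by auto
      then show ?thesis using False by (simp only: card.empty if_False)
    qed
    finally show ?thesis .
  qed
  ultimately show ?thesis by simp
qed

section \<open>Generating functions\<close>

lemma partitions_size_0_right: "partitions_size (Suc k) 0 = {}"
  by (metis add_is_0 all_not_in_conv least_part_def least_part_ex least_part_mem less_numeral_extra(3))

lemma partitions_size_1: "partitions_size (Suc 0) N = (if N = 0 then {} else {{#N#}})"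
  by (auto simp: mem_partitions_size dest!: size_1_singleton_mset[unfolded One_nat_def])

text \<open>Index \<open>k\<close> stands for k + 1 parts, which leaves out the empty partition and
  fits the k + 1 denominator factors found below.\<close>

definition partition_fps :: "nat \<Rightarrow> rat fps" where
  "partition_fps k = Abs_fps (\<lambda>N. of_nat (card (partitions_size (Suc k) N)))"

lemma one_minus_X_power_mult_nth:
  "((1 - fps_X ^ e) * f) $ N = f $ N - (if N < e then 0 else f $ (N - e) :: 'a::comm_ring_1)"
  by (simp add: left_diff_distrib fps_X_power_mult_nth)

lemma partition_fps_rec:
  "(1 - fps_X ^ (2 * k + 3)) * partition_fps (Suc k) = fps_X * partition_fps k"
proof (rule fps_ext)
  fix N
  show "((1 - fps_X ^ (2 * k + 3)) * partition_fps (Suc k)) $ N = (fps_X * partition_fps k) $ N"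
  proof (cases N)
    case 0
    then show ?thesis by (simp add: partition_fps_def partitions_size_0_right)
  next
    case (Suc M)
    then show ?thesis
      unfolding one_minus_X_power_mult_nth
      by (simp add: partition_fps_def card_partitions_size_rec[of k M] not_less del: diff_Suc_Suc)
  qed
qed

lemma one_minus_X_power_neq_0: "b > 0 \<Longrightarrow> (1 - fps_X ^ b :: 'a::field fps) \<noteq> 0"
  using one_minus_X_power_inverse[of b, where 'a = 'a] by auto

lemma partition_fps_eq: "partition_fps k = fps_X ^ Suc k * inv_poch 2 1 (Suc k)"
proof (induction k)
  case 0
  \<comment> \<open>Each positive number has exactly one partition into one part, so the series is
    q/(1 - q).\<close>
  have "(1 - fps_X ^ 1) * partition_fps 0 = fps_X"
    by (rule fps_ext, unfold one_minus_X_power_mult_nth)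
       (auto simp: partition_fps_def partitions_size_1 fps_X_def)
  also have "\<dots> = (1 - fps_X ^ 1) * (fps_X ^ Suc 0 * inv_poch 2 1 (Suc 0))"
    using inv_poch_shift[of 1 2 0, where 'a = rat] by (simp add: mult.left_commute)
  finally show ?case
    using one_minus_X_power_neq_0[of 1] by (metis mult_left_cancel zero_less_one)
next
  case (Suc k)
  have e: "1 + 2 * Suc k = 2 * k + 3" by simp
  have "(1 - fps_X ^ (2 * k + 3)) * partition_fps (Suc k)
      = fps_X ^ Suc (Suc k) * ((1 - fps_X ^ (1 + 2 * Suc k)) * inv_poch 2 1 (Suc (Suc k)))"
    by (subst inv_poch_Suc) (simp_all add: partition_fps_rec Suc.IH mult.assoc)
  also have "\<dots> = (1 - fps_X ^ (2 * k + 3)) * (fps_X ^ Suc (Suc k) * inv_poch 2 1 (Suc (Suc k)))"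
    unfolding e by (rule mult.left_commute)
  finally show ?case
    using one_minus_X_power_neq_0[of "2 * k + 3", where 'a = rat] by (metis mult_left_cancel add_gr_0 zero_less_numeral)
qed

section \<open>The signed count as a power series coefficient\<close>

text \<open>A partition into k + 1 parts gets the sign (-1)^k. A partition of n > 0 has between 1
  and n parts, so k <= n covers all of them; this is also the range in coefficient \<open>n\<close>
  of \<open>diag_sum\<close>.\<close>

lemma d_diff_eq:
  assumes "n > 0"
  shows "int (d_o n) - int (d_e n) = (\<Sum>k\<le>n. (- 1) ^ k * int (card (partitions_size (Suc k) n)))"
proof -
  let ?R = "restricted_partitions n"
  have size: "0 < size P \<and> size P \<le> n" if "P \<in> ?R" for P
  proof
    show "0 < size P" using that assms
      by (auto simp: restricted_partitions_def is_partition_def nonempty_has_size[symmetric])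
    have "(\<forall>p \<in># P. 0 < p) \<Longrightarrow> size P \<le> sum_mset P" for P :: "nat multiset"
      by (induction P) auto
    then show "size P \<le> n"
      using that by (auto simp: restricted_partitions_def is_partition_def)
  qed
  have "int (d_o n) - int (d_e n) = (\<Sum>P\<in>?R. if odd (size P) then 1 else - 1)"
    unfolding d_o_def d_e_def
    by (subst sum.If_cases) (simp_all add: finite_restricted_partitions Int_def Collect_neg_eq[symmetric] conj_commute)
  also have "\<dots> = (\<Sum>k\<le>n. \<Sum>P\<in>{P \<in> ?R. size P - 1 = k}. if odd (size P) then 1 else - 1)"
    by (rule sum.group[symmetric]) (use size in \<open>force simp: finite_restricted_partitions\<close>)+
  also have "\<dots> = (\<Sum>k\<le>n. (- 1) ^ k * int (card (partitions_size (Suc k) n)))"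
  proof (rule sum.cong[OF refl])
    fix k
    have "{P \<in> ?R. size P - 1 = k} = partitions_size (Suc k) n"
      using size by (force simp: partitions_size_def)
    moreover have "(\<Sum>P\<in>partitions_size (Suc k) n. if odd (size P) then 1 else - 1 :: int)
        = (\<Sum>P\<in>partitions_size (Suc k) n. (- 1) ^ k)"
      by (rule sum.cong) (auto simp: partitions_size_def)
    ultimately show "(\<Sum>P\<in>{P \<in> ?R. size P - 1 = k}. if odd (size P) then 1 else - 1)
        = (- 1) ^ k * int (card (partitions_size (Suc k) n))"
      by simp
  qed
  finally show ?thesis .
qed

lemma d_diff_fps:
  assumes "n > 0"
  shows "of_int (int (d_o n) - int (d_e n)) = (fps_X * diag_sum (theta_term 0) :: rat fps) $ n"
proof -
  \<comment> \<open>The numerator q^(k+1) exceeds that of \<open>odd_poch_term 0 k\<close> by one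
    factor q, which becomes the outer \<open>fps_X\<close>.\<close>
  have "(- 1) ^ k * partition_fps k = fps_X * odd_poch_term 0 k" for k
    by (simp add: partition_fps_eq odd_poch_term_def mult_ac)
  then have "diag_sum (\<lambda>k. (- 1) ^ k * partition_fps k) = fps_X * diag_sum (theta_term 0)"
    by (simp only: diag_sum_mult[OF adapted_odd_poch, symmetric] odd_poch_eq_gauss gauss_eq_theta)
  moreover have "((- 1) ^ k * partition_fps k) $ n = (- 1) ^ k * of_nat (card (partitions_size (Suc k) n))" for k
    by (cases "even k") (simp_all add: partition_fps_def)
  then have "of_int (int (d_o n) - int (d_e n)) = diag_sum (\<lambda>k. (- 1) ^ k * partition_fps k) $ n"
    by (simp add: d_diff_eq[OF assms] diag_sum_def)
  ultimately show ?thesis by simp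
qed

lemma theta_nth:
  assumes "n > 0"
  shows "(fps_X * diag_sum (theta_term 0)) $ n =
    (\<Sum>i<n. if n = 6 * i ^ 2 + 4 * i + 1 \<or> n = 6 * i ^ 2 + 8 * i + 3 then (- 1) ^ i else 0 :: 'a::field)"
proof -
  obtain m where m: "n = Suc m" using assms by (metis Suc_pred)
  have "theta_term 0 i $ m
      = (if n = 6 * i ^ 2 + 4 * i + 1 \<or> n = 6 * i ^ 2 + 8 * i + 3 then (- 1) ^ i else 0 :: 'a)" for i
  proof -
    \<comment> \<open>Each index contributes two monomials; the outer \<open>fps_X\<close> raises
      their exponents to 6i^2+4i+1 and 6i^2+8i+3.\<close>
    have "(theta_term 0 i :: 'a fps) = (- 1) ^ i * (fps_X ^ (6 * i ^ 2 + 4 * i) + fps_X ^ (6 * i ^ 2 + 8 * i + 2))"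
    proof -
      have "fps_X ^ (4 * i + 2) * fps_X ^ (6 * i ^ 2 + 4 * i) = (fps_X ^ (6 * i ^ 2 + 8 * i + 2) :: 'a fps)"
        by (simp only: flip: power_add) (rule arg_cong[where f = "(^) fps_X"], simp)
      then show ?thesis
        by (simp only: theta_term_def distrib_left distrib_right mult.assoc add_0 mult_1_left mult_0_right)
    qed
    then show ?thesis
      by (cases "even i") (auto simp: m)
  qed
  then show ?thesis
    by (simp add: m diag_sum_def lessThan_Suc_atMost)
qed

text \<open>The exponents come in disjoint blocks: for a < b, the larger value at a lies below the
  smaller value at b.\<close>

lemma theta_exponent_unique:
  fixes i j n :: nat
  assumes "n = 6 * i ^ 2 + 4 * i + 1 \<or> n = 6 * i ^ 2 + 8 * i + 3"
    and "n = 6 * j ^ 2 + 4 * j + 1 \<or> n = 6 * j ^ 2 + 8 * j + 3"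
  shows "i = j"
proof -
  have lt: "6 * a ^ 2 + 8 * a + 3 < 6 * b ^ 2 + 4 * b + 1" if "a < b" for a b :: nat
  proof -
    have "Suc a ^ 2 \<le> b ^ 2" using that by (intro power_mono) auto
    moreover have "Suc a ^ 2 = a ^ 2 + 2 * a + 1" by (simp add: power2_eq_square)
    ultimately show ?thesis using that by linarith
  qed
  show ?thesis
  proof (rule linorder_cases)
    assume "i < j"
    from lt[OF this] assms show ?thesis by linarith
  next
    assume "j < i"
    from lt[OF this] assms show ?thesis by linarith
  qed
qed

theorem theorem5p2:
  fixes n :: nat
  assumes "n > 0"
  shows "(\<forall>j::nat. n = 6 * j^2 + 4 * j + 1 \<or> n = 6 * j^2 + 8 * j + 3 \<longrightarrow>
            int (d_o n) - int (d_e n) = (-1) ^ j) \<and>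
         ((\<nexists>j::nat. n = 6 * j^2 + 4 * j + 1 \<or> n = 6 * j^2 + 8 * j + 3) \<longrightarrow>
            int (d_o n) - int (d_e n) = 0)"
proof -
  define E where "E i \<longleftrightarrow> n = 6 * i ^ 2 + 4 * i + 1 \<or> n = 6 * i ^ 2 + 8 * i + 3" for i :: nat
  have sum: "of_int (int (d_o n) - int (d_e n)) = (\<Sum>i<n. if E i then (- 1) ^ i else 0 :: rat)"
    using d_diff_fps[OF assms] theta_nth[OF assms, where 'a = rat] by (simp only: E_def)
  have "int (d_o n) - int (d_e n) = (- 1) ^ j" if "E j" for j
  proof -
    have "j < n" using that unfolding E_def by (elim disjE) linarith+
    \<comment> \<open>Uniqueness reduces the sum to its term at \<open>j\<close>, which
      \<open>j < n\<close> places inside the range.\<close>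
    have E: "E i \<longleftrightarrow> i = j" for i
    proof
      assume "E i"
      with that show "i = j" unfolding E_def by (rule theta_exponent_unique[symmetric])
    qed (use that in simp)
    have "(of_int (int (d_o n) - int (d_e n)) :: rat) = of_int ((- 1) ^ j)"
      unfolding sum E using \<open>j < n\<close> by simp
    then show ?thesis by (simp only: of_int_eq_iff)
  qed
  moreover have "int (d_o n) - int (d_e n) = 0" if "\<nexists>j. E j"
  proof -
    have "(of_int (int (d_o n) - int (d_e n)) :: rat) = of_int 0"
      unfolding sum using that by simp
    then show ?thesis by (simp only: of_int_eq_iff)
  qed
  ultimately show ?thesis unfolding E_def by blast
qed

end
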